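(* Every graph with an edge has an avoidable edge. Every graph with at least two edges has two (distinct) avoidable edges.
   Context: Graphs are finite, simple, undirected, with non-empty vertex set. $P_4$ denotes the four-vertex path. An edge $e=uv$ of a graph $G$ is avoidable if every induced $P_4$ in $G$ of the form $x-u-v-y$ (i.e., having $e$ as its middle edge) is contained in an induced cycle of $G$. (In particular, an edge that is the middle edge of no induced $P_4$ is avoidable.) *)

theory Defs
  imports Main
begin

text \<open>A finite simple undirected graph is given by its vertex set and its set of edges,
  an edge being a two-element set of vertices.\<close>

locale simple_graph =
  fixes V :: "'a set" and E :: "'a set set"
  assumes finite_vertices: "finite V"
    and vertices_nonempty: "V \<noteq> {}"
    and edges_subset: "E \<subseteq> {{u, v} | u v. u \<in> V \<and> v \<in> V \<and> u \<noteq> v}"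

definition induced_edges :: "'a set set \<Rightarrow> 'a set \<Rightarrow> 'a set set" where
  "induced_edges E W = {e \<in> E. e \<subseteq> W}"

text \<open>Paths and cycles are represented by the list of their vertices in order; a cycle is
  closed up by the edge joining the last vertex to the first.\<close>

definition path_edges :: "'a list \<Rightarrow> 'a set set" where
  "path_edges xs = {{xs ! i, xs ! Suc i} | i. Suc i < length xs}"

definition cycle_edges :: "'a list \<Rightarrow> 'a set set" where
  "cycle_edges xs = {{xs ! i, xs ! (Suc i mod length xs)} | i. i < length xs}"

definition induced_path :: "'a set \<Rightarrow> 'a set set \<Rightarrow> 'a list \<Rightarrow> bool" where
  "induced_path V E xs \<longleftrightarrow>
     xs \<noteq> [] \<and> distinct xs \<and> set xs \<subseteq> V \<and> induced_edges E (set xs) = path_edges xs"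

definition induced_cycle :: "'a set \<Rightarrow> 'a set set \<Rightarrow> 'a list \<Rightarrow> bool" where
  "induced_cycle V E xs \<longleftrightarrow>
     3 \<le> length xs \<and> distinct xs \<and> set xs \<subseteq> V \<and> induced_edges E (set xs) = cycle_edges xs"

definition avoidable_edge :: "'a set \<Rightarrow> 'a set set \<Rightarrow> 'a set \<Rightarrow> bool" where
  "avoidable_edge V E e \<longleftrightarrow>
     e \<in> E \<and>
     (\<forall>x u v y. e = {u, v} \<and> induced_path V E [x, u, v, y] \<longrightarrow>
        (\<exists>c. induced_cycle V E c \<and>
             set [x, u, v, y] \<subseteq> set c \<and> path_edges [x, u, v, y] \<subseteq> cycle_edges c))"

end

theory Submission
  imports Defs
begin

text \<open>Call an edge \<open>ab\<close> good if, for every induced path \<open>x-a-b-y\<close>, the vertices \<open>x\<close> and \<open>y\<close> are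
  joined by a walk that avoids all other vertices of \<open>N[a] \<union> N[b]\<close>; a shortest such walk closes up
  to an induced cycle, so good edges are avoidable. By induction on the number of vertices, if some
  edge is disjoint from \<open>N[u]\<close>, then some good edge is: enlarge \<open>{u}\<close> to a maximal connected set
  \<open>U\<close> such that \<open>H = G - N[U]\<close> still has an edge, and take a good edge \<open>ab\<close> of \<open>H\<close>. In an induced
  path \<open>x-a-b-y\<close>, either \<open>x\<close> and \<open>y\<close> both lie in \<open>H\<close>, or both have a neighbour in \<open>U\<close> and
  are joined through \<open>U\<close>; if only \<open>x\<close> had one, \<open>U \<union> {x}\<close> would contradict maximality because of
  the edge \<open>by\<close>.

  If \<open>ab\<close> were the only avoidable edge among at least two, the endpoints of every induced path
  \<open>x-c-d-y\<close> would lie outside \<open>N[a] \<union> N[b]\<close>, while every edge would meet both \<open>N[a]\<close> and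
  \<open>N[b]\<close>. So an edge \<open>cd\<close> that is not avoidable has \<open>c\<close> and \<open>d\<close> in \<open>N(a) \<inter> N(b)\<close>, which
  is impossible for the edge \<open>ac\<close>.\<close>

section \<open>Good edges of a symmetric irreflexive relation\<close>

locale adjacency =
  fixes adj :: "'a \<Rightarrow> 'a \<Rightarrow> bool"
  assumes adj_sym: "adj p q \<Longrightarrow> adj q p"
    and adj_irrefl: "\<not> adj p p"
begin

definition closed_nbh :: "'a set \<Rightarrow> 'a set" where
  "closed_nbh U = U \<union> {q. \<exists>p\<in>U. adj p q}"

definition link :: "'a set \<Rightarrow> ('a \<times> 'a) set" where
  "link S = {(p, q). p \<in> S \<and> q \<in> S \<and> adj p q}"

definition connected_set :: "'a set \<Rightarrow> bool" where
  "connected_set U \<longleftrightarrow> (\<forall>p\<in>U. \<forall>q\<in>U. (p, q) \<in> (link U)\<^sup>*)"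

definition is_P4 :: "'a \<Rightarrow> 'a \<Rightarrow> 'a \<Rightarrow> 'a \<Rightarrow> bool" where
  "is_P4 x a b y \<longleftrightarrow> adj x a \<and> adj a b \<and> adj b y \<and>
     \<not> adj x b \<and> \<not> adj a y \<and> \<not> adj x y \<and> x \<noteq> b \<and> y \<noteq> a"

text \<open>The ends \<open>x\<close> and \<open>y\<close> of an induced path \<open>x-a-b-y\<close>
  lie in the removed neighbourhood themselves, so they are put back; \<open>a\<close> and
  \<open>b\<close> stay out.\<close>

definition room :: "'a set \<Rightarrow> 'a \<Rightarrow> 'a \<Rightarrow> 'a \<Rightarrow> 'a \<Rightarrow> 'a set" where
  "room V x a b y = V - (closed_nbh {a, b} - {x, y})"

text \<open>The vertex set is an argument while adjacency is fixed, so passing to an induced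
  subgraph in the induction only replaces \<open>V\<close> by a subset.\<close>

definition good :: "'a set \<Rightarrow> 'a \<Rightarrow> 'a \<Rightarrow> bool" where
  "good V a b \<longleftrightarrow> a \<in> V \<and> b \<in> V \<and> adj a b \<and>
     (\<forall>x\<in>V. \<forall>y\<in>V. is_P4 x a b y \<longrightarrow> (y, x) \<in> (link (room V x a b y))\<^sup>*)"

lemma adj_commute: "adj p q \<longleftrightarrow> adj q p"
  using adj_sym by blast

lemma link_mono: "S \<subseteq> T \<Longrightarrow> (link S)\<^sup>* \<subseteq> (link T)\<^sup>*"
  by (rule rtrancl_mono) (auto simp: link_def)

lemma link_rtrancl_sym: "(p, q) \<in> (link S)\<^sup>* \<Longrightarrow> (q, p) \<in> (link S)\<^sup>*"
  by (rule symD[OF sym_rtrancl]) (auto simp: sym_def link_def adj_commute)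

lemma good_sym: "good V a b \<Longrightarrow> good V b a"
proof -
  assume g: "good V a b"
  have "(y, x) \<in> (link (room V x b a y))\<^sup>*" if "x \<in> V" "y \<in> V" "is_P4 x b a y" for x y
  proof -
    have "is_P4 y a b x" using that(3) by (auto simp: is_P4_def adj_commute)
    then have "(x, y) \<in> (link (room V y a b x))\<^sup>*" using g that by (auto simp: good_def)
    moreover have "room V y a b x = room V x b a y"
      by (simp add: room_def insert_commute)
    ultimately show ?thesis using link_rtrancl_sym by simp
  qed
  then show ?thesis using g by (auto simp: good_def adj_commute)
qed

lemma connected_set_insert:
  assumes U: "connected_set U" and p: "p \<in> U" "adj p x"
  shows "connected_set (insert x U)"
proof -
  have to_p: "(q, p) \<in> (link (insert x U))\<^sup>*" if "q \<in> insert x U" for q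
  proof (cases "q = x")
    case True
    then have "(q, p) \<in> link (insert x U)" using p by (auto simp: link_def adj_commute)
    then show ?thesis by blast
  next
    case False
    then have "(q, p) \<in> (link U)\<^sup>*" using U p that by (auto simp: connected_set_def)
    then show ?thesis using link_mono[of U "insert x U"] by blast
  qed
  then show ?thesis
    unfolding connected_set_def by (meson link_rtrancl_sym rtrancl_trans)
qed

text \<open>Finiteness gives a maximal candidate. Attaching a neighbour keeps it connected, so only
  \<open>P\<close> can fail for the enlarged set.\<close>

lemma maximal_connected_set:
  assumes "finite V" "u \<in> V" "P {u}"
  obtains U where "u \<in> U" "U \<subseteq> V" "connected_set U" "P U"
    "\<And>x p. \<lbrakk>x \<in> V - U; p \<in> U; adj p x\<rbrakk> \<Longrightarrow> \<not> P (insert x U)"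
proof -
  let ?F = "{U. u \<in> U \<and> U \<subseteq> V \<and> connected_set U \<and> P U}"
  have "finite ?F" using assms(1) by (auto intro: finite_subset[of _ "Pow V"])
  moreover have "{u} \<in> ?F" using assms by (auto simp: connected_set_def)
  ultimately obtain U where U: "U \<in> ?F" "\<And>W. W \<in> ?F \<Longrightarrow> U \<subseteq> W \<Longrightarrow> U = W"
    using finite_has_maximal[of ?F] by (metis (no_types, lifting) empty_iff)
  have "\<not> P (insert x U)" if x: "x \<in> V - U" "p \<in> U" "adj p x" for x p
  proof
    assume "P (insert x U)"
    then have "insert x U \<in> ?F" using x U(1) connected_set_insert[of U p x] by auto
    then show False using U(2)[of "insert x U"] x by blast
  qed
  then show thesis using U(1) that by auto
qed

lemma good_lift:
  assumes U: "U \<subseteq> V" "connected_set U"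
    and maxi: "\<And>x p c d. \<lbrakk>x \<in> V - U; p \<in> U; adj p x; c \<in> V - closed_nbh (insert x U);
      d \<in> V - closed_nbh (insert x U)\<rbrakk> \<Longrightarrow> \<not> adj c d"
    and g: "good (V - closed_nbh U) a b"
  shows "good V a b"
proof -
  let ?H = "V - closed_nbh U"
  have ab: "a \<in> ?H" "b \<in> ?H" "adj a b" using g by (auto simp: good_def)
  \<comment> \<open>\<open>a\<close> and \<open>b\<close> are generalised so that the claim also
    applies to the reversed path \<open>y-b-a-x\<close>.\<close>
  have no_mixed: "y \<in> closed_nbh U"
    if "good ?H a b" "x \<in> V" "y \<in> V" "is_P4 x a b y" and x: "x \<in> closed_nbh U" for x y a b
  proof (rule ccontr)
    assume y: "y \<notin> closed_nbh U"
    have ab: "a \<in> ?H" "b \<in> ?H" using that by (auto simp: good_def)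
    have "x \<notin> U" using that ab by (auto simp: is_P4_def closed_nbh_def)
    moreover obtain p where "p \<in> U" "adj p x"
      using \<open>x \<notin> U\<close> x unfolding closed_nbh_def by blast
    \<comment> \<open>Since \<open>x\<close> is neither equal nor adjacent to \<open>b\<close> or
      \<open>y\<close>, the edge \<open>by\<close> survives when \<open>x\<close> joins
      \<open>U\<close>, against \<open>maxi\<close>.\<close>
    moreover have "b \<in> V - closed_nbh (insert x U)" "y \<in> V - closed_nbh (insert x U)"
      using y ab that by (auto simp: closed_nbh_def is_P4_def adj_commute)
    ultimately show False using maxi[of x p b y] that by (auto simp: is_P4_def)
  qed
  have "(y, x) \<in> (link (room V x a b y))\<^sup>*" if xy: "x \<in> V" "y \<in> V" "is_P4 x a b y" for x y
  proof -
    have rev: "is_P4 y b a x" using xy(3) by (auto simp: is_P4_def adj_commute)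
    have iff: "x \<in> closed_nbh U \<longleftrightarrow> y \<in> closed_nbh U"
      using no_mixed[OF g xy] no_mixed[OF good_sym[OF g] xy(2,1) rev] by blast
    show ?thesis
    proof (cases "x \<in> closed_nbh U")
      case False
      then have "(y, x) \<in> (link (room ?H x a b y))\<^sup>*"
        using g xy iff by (auto simp: good_def)
      moreover have "room ?H x a b y \<subseteq> room V x a b y" by (auto simp: room_def)
      ultimately show ?thesis using link_mono by blast
    next
      case True
      have nU: "x \<notin> U" "y \<notin> U" using xy ab by (auto simp: is_P4_def closed_nbh_def adj_commute)
      obtain p q where pq: "p \<in> U" "adj p x" "q \<in> U" "adj q y"
        using True iff nU by (auto simp: closed_nbh_def)
      \<comment> \<open>Both \<open>a\<close> and \<open>b\<close> lie outside the closed
        neighbourhood of \<open>U\<close>, so no vertex of \<open>U\<close> is equal or adjacent to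
        either of them.\<close>
      have sub: "U \<subseteq> room V x a b y"
        using U ab by (auto simp: room_def closed_nbh_def adj_commute)
      have xyr: "x \<in> room V x a b y" "y \<in> room V x a b y" using xy by (auto simp: room_def)
      have "(y, q) \<in> link (room V x a b y)" "(p, x) \<in> link (room V x a b y)"
        using pq sub xyr by (auto simp: link_def adj_commute)
      moreover have "(q, p) \<in> (link (room V x a b y))\<^sup>*"
        using U(2) pq link_mono[OF sub] by (auto simp: connected_set_def)
      ultimately show ?thesis
        by (meson converse_rtrancl_into_rtrancl rtrancl.rtrancl_into_rtrancl)
    qed
  qed
  then show ?thesis using ab by (auto simp: good_def)
qed

text \<open>An edge \<open>ab\<close> that is the middle of no induced path is vacuously good.
  Otherwise, in a path \<open>x-a-b-y\<close>, the edge \<open>by\<close> is far from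
  \<open>x\<close>, and \<open>far\<close> applies.\<close>

lemma good_edge_if:
  assumes "a \<in> V" "b \<in> V" "adj a b"
    and far: "\<And>w c d. \<lbrakk>w \<in> V; c \<in> V - closed_nbh {w}; d \<in> V - closed_nbh {w}; adj c d\<rbrakk>
      \<Longrightarrow> \<exists>a b. good V a b"
  shows "\<exists>a b. good V a b"
proof (cases "\<exists>x\<in>V. \<exists>y\<in>V. is_P4 x a b y")
  case True
  then obtain x y where xy: "x \<in> V" "y \<in> V" "is_P4 x a b y" by blast
  then have "b \<in> V - closed_nbh {x}" "y \<in> V - closed_nbh {x}" "adj b y"
    using assms(2) by (auto simp: is_P4_def closed_nbh_def adj_commute)
  then show ?thesis using far xy(1) by blast
next
  case False
  then have "good V a b" using assms by (auto simp: good_def)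
  then show ?thesis by blast
qed

lemma good_edge_far:
  assumes "finite V" "u \<in> V" "c \<in> V - closed_nbh {u}" "d \<in> V - closed_nbh {u}" "adj c d"
  shows "\<exists>a b. good V a b \<and> a \<notin> closed_nbh {u} \<and> b \<notin> closed_nbh {u}"
  using assms
proof (induction "card V" arbitrary: V u c d rule: less_induct)
  case less
  let ?P = "\<lambda>U. \<exists>c d. c \<in> V - closed_nbh U \<and> d \<in> V - closed_nbh U \<and> adj c d"
  have "?P {u}" using less.prems by blast
  then obtain U where U: "u \<in> U" "U \<subseteq> V" "connected_set U" "?P U"
    and maxi: "\<And>x p. \<lbrakk>x \<in> V - U; p \<in> U; adj p x\<rbrakk> \<Longrightarrow> \<not> ?P (insert x U)"
    using maximal_connected_set[of V u ?P] less.prems by (smt (verit, del_insts))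
  let ?H = "V - closed_nbh U"
  have "?H \<subset> V" using U by (auto simp: closed_nbh_def)
  then have card: "card ?H < card V" using less.prems(1) by (rule psubset_card_mono[rotated])
  obtain c' d' where cd: "c' \<in> ?H" "d' \<in> ?H" "adj c' d'" using U(4) by blast
  have "\<exists>a b. good ?H a b"
  \<comment> \<open>Here \<open>far\<close> is the induction hypothesis for \<open>?H\<close>, which
    is smaller than \<open>V\<close> because it misses \<open>u\<close>.\<close>
  proof (rule good_edge_if[OF cd])
    fix w c d
    assume "w \<in> ?H" "c \<in> ?H - closed_nbh {w}" "d \<in> ?H - closed_nbh {w}" "adj c d"
    then show "\<exists>a b. good ?H a b"
      using less.hyps[OF card, of w c d] less.prems(1) by blast
  qed
  then obtain a b where ab: "good ?H a b" by blast
  have "good V a b" using good_lift[OF U(2,3) _ ab] maxi by blast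
  moreover have "closed_nbh {u} \<subseteq> closed_nbh U" using U(1) by (auto simp: closed_nbh_def)
  moreover have "a \<in> ?H" "b \<in> ?H" using ab by (auto simp: good_def)
  ultimately show ?case by blast
qed

lemma good_edge:
  assumes "finite V" "a \<in> V" "b \<in> V" "adj a b"
  shows "\<exists>a b. good V a b"
  using good_edge_if[OF assms(2-4)] good_edge_far[OF assms(1)] by blast

text \<open>A repeated vertex or a chord would shorten a walk of least length. Membership in
  \<open>S\<close> is claimed only along steps, since the trivial walk with \<open>y = x\<close> may
  lie outside \<open>S\<close>.\<close>

lemma shortest_walk:
  assumes "(y, x) \<in> (link S)\<^sup>*"
  obtains f n where "f 0 = y" "f n = x" "inj_on f {..n}"
    "\<forall>i<n. f i \<in> S \<and> f (Suc i) \<in> S"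
    "\<forall>i j. i < j \<longrightarrow> j \<le> n \<longrightarrow> (adj (f i) (f j) \<longleftrightarrow> j = Suc i)"
proof -
  define n where "n = (LEAST n. (y, x) \<in> link S ^^ n)"
  have n: "(y, x) \<in> link S ^^ n"
    unfolding n_def using assms by (metis LeastI rtrancl_imp_relpow)
  obtain f where f: "f 0 = y" "f n = x" "\<forall>i<n. (f i, f (Suc i)) \<in> link S"
    using iffD1[OF relpow_fun_conv n] by blast
  have seg: "(f i, f (i + k)) \<in> link S ^^ k" if "i + k \<le> n" for i k
    using that
  proof (induction k)
    case (Suc k)
    then show ?case using f(3) by auto
  qed simp
  \<comment> \<open>Replacing the stretch from \<open>f i\<close> to \<open>f j\<close> by
    \<open>k\<close> steps cannot beat the minimum; \<open>k = 0\<close> excludes repetitions and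
    \<open>k = 1\<close> excludes chords.\<close>
  have short: "n \<le> i + k + (n - j)"
    if "i \<le> n" "j \<le> n" "(f i, f j) \<in> link S ^^ k" for i j k
  proof -
    have "(y, f i) \<in> link S ^^ i" "(f j, x) \<in> link S ^^ (n - j)"
      using seg[of 0 i] seg[of j "n - j"] that f by auto
    then have "(y, x) \<in> link S ^^ (i + k + (n - j))"
      using that(3) by (auto simp: relpow_add)
    then show ?thesis unfolding n_def by (rule Least_le)
  qed
  have mem: "f i \<in> S \<and> f (Suc i) \<in> S" if "i < n" for i
    using f(3) that by (auto simp: link_def)
  have "f i \<noteq> f j" if "i < j" "j \<le> n" for i j
    using short[of i j 0] that by auto
  then have "inj_on f {..n}"
    by (intro linorder_inj_onI) auto
  moreover have "adj (f i) (f j) \<longleftrightarrow> j = Suc i" if ij: "i < j" "j \<le> n" for i j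
  proof
    assume "adj (f i) (f j)"
    moreover have "f i \<in> S" "f j \<in> S" using mem[of i] mem[of "j - 1"] ij by auto
    ultimately have "(f i, f j) \<in> link S ^^ 1" by (simp add: link_def)
    then show "j = Suc i" using short[of i j 1] ij by auto
  next
    assume "j = Suc i"
    then show "adj (f i) (f j)" using f(3) ij by (auto simp: link_def)
  qed
  ultimately show thesis using that f(1,2) mem by blast
qed

end

text \<open>Ordering each pair of indices as \<open>i < j\<close> removes the modulus: the closing
  edge is the pair of index 0 and the last index.\<close>

lemma induced_cycleI:
  assumes len: "3 \<le> length c" and "distinct c" "set c \<subseteq> V"
    and edges: "E \<subseteq> {{u, v} | u v. u \<noteq> v}"
    and adj: "\<And>i j. i < j \<Longrightarrow> j < length c \<Longrightarrow>
      {c ! i, c ! j} \<in> E \<longleftrightarrow> j = Suc i \<or> (i = 0 \<and> Suc j = length c)"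
  shows "induced_cycle V E c"
proof -
  have "induced_edges E (set c) \<subseteq> cycle_edges c"
  proof
    fix e assume "e \<in> induced_edges E (set c)"
    then have e: "e \<in> E" "e \<subseteq> set c" by (auto simp: induced_edges_def)
    then obtain u v where uv: "e = {u, v}" "u \<noteq> v" using edges by blast
    then obtain i' j' where "i' < length c" "j' < length c" "u = c ! i'" "v = c ! j'"
      using e(2) by (auto simp: in_set_conv_nth)
    then obtain i j where ij: "i < j" "j < length c" "e = {c ! i, c ! j}"
      using uv by (metis insert_commute linorder_neqE_nat)
    then consider "j = Suc i" | "i = 0" "Suc j = length c" using adj e(1) by blast
    then show "e \<in> cycle_edges c"
    proof cases
      case 1
      then have "e = {c ! i, c ! (Suc i mod length c)}" using ij by simp
      then show ?thesis using ij unfolding cycle_edges_def by force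
    next
      case 2
      then have "e = {c ! j, c ! (Suc j mod length c)}" using ij by auto
      then show ?thesis using ij unfolding cycle_edges_def by blast
    qed
  qed
  moreover have "cycle_edges c \<subseteq> induced_edges E (set c)"
  proof
    fix e assume "e \<in> cycle_edges c"
    then obtain i where i: "i < length c" "e = {c ! i, c ! (Suc i mod length c)}"
      by (auto simp: cycle_edges_def)
    have "e \<in> E"
    proof (cases "Suc i = length c")
      case True
      then show ?thesis using i adj[of 0 i] len by (simp add: insert_commute)
    next
      case False
      then show ?thesis using i adj[of i "Suc i"] by simp
    qed
    moreover have "Suc i mod length c < length c" using len by (intro mod_less_divisor) auto
    ultimately show "e \<in> induced_edges E (set c)" using i by (auto simp: induced_edges_def)
  qed
  ultimately show ?thesis using assms by (auto simp: induced_cycle_def)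
qed

lemma path_edges_four: "path_edges [x, a, b, y] = {{x, a}, {a, b}, {b, y}}"
proof -
  have "{i. Suc i < 4} = {0, 1, 2 :: nat}" by auto
  moreover have "path_edges [x, a, b, y] =
      (\<lambda>i. {[x, a, b, y] ! i, [x, a, b, y] ! Suc i}) ` {i. Suc i < 4}"
    by (auto simp: path_edges_def numeral_eq_Suc)
  ultimately show ?thesis by simp
qed

section \<open>Good edges of a graph are avoidable\<close>

context simple_graph
begin

sublocale adjacency "\<lambda>p q. {p, q} \<in> E"
  using edges_subset by unfold_locales (auto simp: insert_commute doubleton_eq_iff)

lemma edge_vertices: "{p, q} \<in> E \<Longrightarrow> p \<in> V \<and> q \<in> V"
  using edges_subset by (auto simp: doubleton_eq_iff)

lemma induced_path_is_P4:
  assumes "induced_path V E [x, a, b, y]"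
  shows "x \<in> V" "y \<in> V" "is_P4 x a b y"
proof -
  have d: "distinct [x, a, b, y]" and V: "{x, a, b, y} \<subseteq> V"
    and ind: "induced_edges E {x, a, b, y} = path_edges [x, a, b, y]"
    using assms by (auto simp: induced_path_def)
  have E: "{p, q} \<in> E \<longleftrightarrow> {p, q} \<in> {{x, a}, {a, b}, {b, y}}"
    if "p \<in> {x, a, b, y}" "q \<in> {x, a, b, y}" for p q
  proof -
    have "{p, q} \<in> E \<longleftrightarrow> {p, q} \<in> induced_edges E {x, a, b, y}"
      using that unfolding induced_edges_def by simp
    then show ?thesis unfolding ind path_edges_four .
  qed
  show "x \<in> V" "y \<in> V" using V by auto
  show "is_P4 x a b y"
    unfolding is_P4_def using d by (auto simp: E doubleton_eq_iff)
qed

lemma good_closes_cycle: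
  assumes g: "good V a b" and xy: "x \<in> V" "y \<in> V" "is_P4 x a b y"
  obtains c where "induced_cycle V E c" "{x, a, b, y} \<subseteq> set c"
    "{{x, a}, {a, b}, {b, y}} \<subseteq> cycle_edges c"
proof -
  have ab: "a \<in> V" "b \<in> V" "{a, b} \<in> E"
    and walk: "(y, x) \<in> (link (room V x a b y))\<^sup>*" using g xy by (auto simp: good_def)
  obtain f n where f: "f 0 = y" "f n = x" "inj_on f {..n}"
    and room: "\<forall>i<n. f i \<in> room V x a b y \<and> f (Suc i) \<in> room V x a b y"
    and adj: "\<forall>i j. i < j \<longrightarrow> j \<le> n \<longrightarrow> ({f i, f j} \<in> E \<longleftrightarrow> j = Suc i)"
    using walk by (rule shortest_walk)
  have neq: "x \<noteq> y" "x \<noteq> a" "x \<noteq> b" "y \<noteq> a" "y \<noteq> b"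
    using xy adj_irrefl by (auto simp: is_P4_def insert_commute)
  have n: "0 < n" using neq f by (metis gr0I)
  have mem: "f i \<in> room V x a b y" if "i \<le> n" for i
    using room that n by (cases i) auto
  \<comment> \<open>In the room only \<open>x\<close> is adjacent to \<open>a\<close> and only
    \<open>y\<close> to \<open>b\<close>; injectivity of \<open>f\<close> places them at the indices
    \<open>n\<close> and 0.\<close>
  have a_f: "{a, f i} \<in> E \<longleftrightarrow> i = n" and b_f: "{b, f i} \<in> E \<longleftrightarrow> i = 0"
    and ab_f: "f i \<noteq> a" "f i \<noteq> b" if "i \<le> n" for i
  proof -
    have "f i = y \<longleftrightarrow> i = 0" "f i = x \<longleftrightarrow> i = n"
      using f(3) that inj_onD[OF f(3), of i 0] inj_onD[OF f(3), of i n] f(1,2) by auto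
    then show "{a, f i} \<in> E \<longleftrightarrow> i = n" "{b, f i} \<in> E \<longleftrightarrow> i = 0" "f i \<noteq> a" "f i \<noteq> b"
      using mem[OF that] xy(3) neq
      by (auto simp: room_def closed_nbh_def is_P4_def insert_commute)
  qed
  \<comment> \<open>The walk runs from \<open>y\<close> to \<open>x\<close>, so it continues the
    edge \<open>ab\<close> and closes up at \<open>a\<close>; walk vertices are shifted by two
    positions.\<close>
  define c where "c = a # b # map f [0..<Suc n]"
  have len: "length c = n + 3" by (simp add: c_def)
  have nth: "c ! 0 = a" "c ! Suc 0 = b" "\<And>i. i \<le> n \<Longrightarrow> c ! Suc (Suc i) = f i"
    by (auto simp: c_def simp del: upt_Suc)
  have cyc: "induced_cycle V E c"
  proof (rule induced_cycleI)
    show "3 \<le> length c" by (simp add: len)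
    have "{0..<Suc n} = {..n}" by auto
    moreover have "a \<noteq> b" using ab(3) adj_irrefl by auto
    ultimately show "distinct c"
      using f(3) ab_f by (force simp: c_def distinct_map simp del: upt_Suc)
    show "set c \<subseteq> V" using ab mem by (auto simp: c_def room_def simp del: upt_Suc)
    show "E \<subseteq> {{u, v} | u v. u \<noteq> v}" using edges_subset by blast
    fix i j assume ij: "i < j" "j < length c"
    show "{c ! i, c ! j} \<in> E \<longleftrightarrow> j = Suc i \<or> (i = 0 \<and> Suc j = length c)"
    proof (cases "j = 1")
      case True
      then show ?thesis using ij ab nth len by auto
    next
      case False
      then obtain l where l: "j = Suc (Suc l)" "l \<le> n"
        using ij len by (auto intro: that[of "j - 2"])
      consider "i = 0" | "i = Suc 0" | k where "i = Suc (Suc k)" by (metis not0_implies_Suc)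
      then show ?thesis
      proof cases
        case 3
        then show ?thesis using l ij nth adj by auto
      qed (use l nth a_f b_f len in auto)
    qed
  qed
  have "f 0 \<in> set c" "f n \<in> set c" by (auto simp: c_def simp del: upt_Suc)
  then have sub: "{x, a, b, y} \<subseteq> set c" using f by (auto simp: c_def)
  moreover have "{{x, a}, {a, b}, {b, y}} \<subseteq> induced_edges E (set c)"
    using sub xy(3) by (auto simp: induced_edges_def is_P4_def)
  ultimately show thesis using cyc that by (auto simp: induced_cycle_def)
qed

lemma good_imp_avoidable:
  assumes "good V a b"
  shows "avoidable_edge V E {a, b}"
  unfolding avoidable_edge_def
proof (intro conjI allI impI)
  show "{a, b} \<in> E" using assms by (simp add: good_def)
  fix x u v y
  assume h: "{a, b} = {u, v} \<and> induced_path V E [x, u, v, y]"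
  \<comment> \<open>The unordered edge may be traversed in either direction.\<close>
  have uv: "good V u v" using assms good_sym h by (auto simp: doubleton_eq_iff)
  obtain c where "induced_cycle V E c" "{x, u, v, y} \<subseteq> set c"
    "{{x, u}, {u, v}, {v, y}} \<subseteq> cycle_edges c"
    using good_closes_cycle[OF uv] induced_path_is_P4 h by metis
  then show "\<exists>c. induced_cycle V E c \<and> set [x, u, v, y] \<subseteq> set c \<and>
      path_edges [x, u, v, y] \<subseteq> cycle_edges c"
    unfolding path_edges_four by auto
qed

lemma avoidable_edge_far:
  assumes "u \<in> V" "{c, d} \<in> E" "c \<notin> closed_nbh {u}" "d \<notin> closed_nbh {u}"
  obtains e where "avoidable_edge V E e" "e \<inter> closed_nbh {u} = {}"
proof -
  obtain a b where "good V a b" "a \<notin> closed_nbh {u}" "b \<notin> closed_nbh {u}"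
    using good_edge_far[OF finite_vertices, of u c d] assms edge_vertices by blast
  then show thesis using that[of "{a, b}"] good_imp_avoidable by blast
qed

section \<open>Existence of one and of two avoidable edges\<close>

lemma not_avoidable_cases:
  assumes "e \<in> E" "\<not> avoidable_edge V E e"
  obtains x c d y where "e = {c, d}" "x \<in> V" "y \<in> V" "is_P4 x c d y"
proof -
  obtain x c d y where "e = {c, d}" "induced_path V E [x, c, d, y]"
    using assms unfolding avoidable_edge_def by blast
  then show thesis using that induced_path_is_P4 by blast
qed

lemma exists_avoidable_edge:
  assumes "E \<noteq> {}"
  obtains a b where "avoidable_edge V E {a, b}" "{a, b} \<in> E"
proof -
  obtain c d where "{c, d} \<in> E" using assms edges_subset by blast
  then obtain a b where "good V a b"
    using good_edge[OF finite_vertices] edge_vertices by metis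
  then show thesis using that good_imp_avoidable by (auto simp: good_def)
qed

lemma unique_avoidable_edge:
  assumes ab: "avoidable_edge V E {a, b}" "{a, b} \<in> E"
    and unique: "\<And>f. avoidable_edge V E f \<Longrightarrow> f = {a, b}"
    and e: "e \<in> E"
  shows "e = {a, b}"
proof -
  \<comment> \<open>An edge far from \<open>w\<close> would yield an avoidable edge missing
    \<open>w\<close>, hence different from \<open>ab\<close>.\<close>
  have far: "p \<in> closed_nbh {w} \<or> q \<in> closed_nbh {w}"
    if w: "w \<in> {a, b}" and pq: "{p, q} \<in> E" for w p q
  proof (rule ccontr)
    assume "\<not> ?thesis"
    then obtain f where "avoidable_edge V E f" "f \<inter> closed_nbh {w} = {}"
      using avoidable_edge_far[of w p q] w pq ab(2) edge_vertices by blast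
    then show False using unique w by (auto simp: closed_nbh_def)
  qed
  \<comment> \<open>The edge \<open>dy\<close> is far from \<open>x\<close>, so some avoidable edge
    is too, and by uniqueness it is \<open>ab\<close>.\<close>
  have ends: "x \<notin> closed_nbh {w}"
    if w: "w \<in> {a, b}" and P4: "x \<in> V" "is_P4 x c d y" for w x c d y
  proof -
    have "y \<noteq> x" using P4(2) by (auto simp: is_P4_def insert_commute)
    then have "{d, y} \<in> E" "d \<notin> closed_nbh {x}" "y \<notin> closed_nbh {x}"
      using P4(2) by (auto simp: is_P4_def closed_nbh_def)
    then obtain f where "avoidable_edge V E f" "f \<inter> closed_nbh {x} = {}"
      by (rule avoidable_edge_far[OF P4(1)])
    then have "w \<notin> closed_nbh {x}" using unique w by blast
    then show ?thesis by (auto simp: closed_nbh_def insert_commute)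
  qed
  \<comment> \<open>The edge \<open>xc\<close> must meet the closed neighbourhood of
    \<open>w\<close>, and by \<open>ends\<close> it can do so only at \<open>c\<close>; moreover
    \<open>c\<close> is not \<open>w\<close>, as \<open>x\<close> is adjacent to
    \<open>c\<close>.\<close>
  have inner: "{w, c} \<in> E"
    if w: "w \<in> {a, b}" and P4: "x \<in> V" "is_P4 x c d y" for w x c d y
  proof -
    have "x \<notin> closed_nbh {w}" by (rule ends[OF that])
    moreover from this have "c \<in> closed_nbh {w}" using far[OF w, of x c] P4 by (auto simp: is_P4_def)
    ultimately show ?thesis using P4 by (auto simp: closed_nbh_def is_P4_def insert_commute)
  qed
  have both: "{w, z} \<in> E"
    if w: "w \<in> {a, b}" and f: "f \<in> E" "\<not> avoidable_edge V E f" "z \<in> f" for w f z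
  proof -
    obtain x c d y where P4: "f = {c, d}" "x \<in> V" "y \<in> V" "is_P4 x c d y"
      using not_avoidable_cases[OF f(1,2)] .
    have "is_P4 y d c x" using P4(4) by (auto simp: is_P4_def insert_commute)
    then show ?thesis using inner[OF w P4(2,4)] inner[OF w P4(3)] f(3) P4(1) by blast
  qed
  show ?thesis
  proof (rule ccontr)
    assume ne: "e \<noteq> {a, b}"
    then have na: "\<not> avoidable_edge V E e" using unique by blast
    obtain c where "c \<in> e" using e edges_subset by blast
    then have c: "{a, c} \<in> E" "{b, c} \<in> E" using both e na by auto
    then have "c \<noteq> b" using adj_irrefl by auto
    then have "{a, c} \<noteq> {a, b}" by (auto simp: doubleton_eq_iff)
    \<comment> \<open>The edge \<open>ac\<close> is not avoidable either, so \<open>both\<close>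
      makes \<open>a\<close> adjacent to its own endpoint \<open>a\<close>.\<close>
    then have "{a, a} \<in> E" using both[of a "{a, c}" a] unique c by blast
    then show False using adj_irrefl by blast
  qed
qed

end

theorem theorem6p4:
  fixes V :: "'a set" and E :: "'a set set"
  assumes "simple_graph V E"
  shows "(E \<noteq> {} \<longrightarrow> (\<exists>e. avoidable_edge V E e)) \<and>
         (card E \<ge> 2 \<longrightarrow>
           (\<exists>e f. e \<noteq> f \<and> avoidable_edge V E e \<and> avoidable_edge V E f))"
proof (intro conjI impI)
  interpret simple_graph V E by (rule assms)
  show "\<exists>e. avoidable_edge V E e" if "E \<noteq> {}"
    using exists_avoidable_edge[OF that] by blast
  assume card: "card E \<ge> 2"
  then have "E \<noteq> {}" by auto
  then obtain a b where ab: "avoidable_edge V E {a, b}" "{a, b} \<in> E"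
    by (rule exists_avoidable_edge)
  show "\<exists>e f. e \<noteq> f \<and> avoidable_edge V E e \<and> avoidable_edge V E f"
  proof (rule ccontr)
    assume "\<not> ?thesis"
    then have "f = {a, b}" if "avoidable_edge V E f" for f using ab(1) that by metis
    then have "e = {a, b}" if "e \<in> E" for e using unique_avoidable_edge[OF ab _ that] by metis
    then have "E \<subseteq> {{a, b}}" by blast
    then have "card E \<le> 1" using card_mono[of "{{a, b}}" E] by simp
    then show False using card by simp
  qed
qed

end
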